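(* Let $f:\mathbb{R}^n\to\mathbb{R}\cup\{\infty\}$ be a proper, lower semicontinuous, convex function with $\mathrm{dom}\,f$ unbounded. Then: (i) $\partial f(\infty)$ is a closed convex set, and $\partial^\infty f(\infty)$ is a closed convex cone; (ii) if $\|x_k\|\to\infty$, $u_k\in\partial f(x_k)$ and $u_k\to u$, then $u\in\partial f(\infty)$; (iii) $\partial^M f(\infty)=\mathop{\mathrm{Lim\,sup}}_{x\to\infty}\partial f(x)\subset\partial f(\infty)$.
   Context: $\mathrm{dom}\,f=\{x\mid f(x)<\infty\}$; $f$ is proper if $\mathrm{dom}\,f\ne\emptyset$; $\mathrm{epi}\,f=\{(x,r)\in\mathbb{R}^n\times\mathbb{R}\mid r\ge f(x)\}$. For a convex set $E$ and $z\in E$, $N(z;E)=\{v\mid\langle v,y-z\rangle\le 0\ \forall y\in E\}$. For $x\in\mathrm{dom}\,f$, $\partial f(x)=\{u\mid(u,-1)\in N((x,f(x));\mathrm{epi}\,f)\}$ (the usual convex subdifferential). With $I=\{1,\dots,n\}$ selecting the $x$-coordinates in $\mathbb{R}^n\times\mathbb{R}$: $T(\infty_I;\mathrm{epi}\,f)$ is the set of $(w,\rho)\in\mathbb{R}^n\times\mathbb{R}$ such that for all sequences $(x_k,r_k)\in\mathrm{epi}\,f$ with $\|x_k\|\to\infty$ and all $t_k>0$ with $t_k\to0$ there exist $(w_k,\rho_k)\to(w,\rho)$ with $(x_k,r_k)+t_k(w_k,\rho_k)\in\mathrm{epi}\,f$ for all $k$. $N(\infty_I;\mathrm{epi}\,f)=\{(u,c)\mid\langle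 u,w\rangle+c\rho\le0\ \forall(w,\rho)\in T(\infty_I;\mathrm{epi}\,f)\}$. $N^M(\infty_I;\mathrm{epi}\,f)$ is the set of limits of convergent sequences $v_k\in N((x_k,r_k);\mathrm{epi}\,f)$ with $(x_k,r_k)\in\mathrm{epi}\,f$ and $\|x_k\|\to\infty$. $\partial f(\infty)=\{u\mid(u,-1)\in N(\infty_I;\mathrm{epi}\,f)\}$, $\partial^\infty f(\infty)=\{u\mid(u,0)\in N(\infty_I;\mathrm{epi}\,f)\}$, $\partial^Mf(\infty)=\{u\mid(u,-1)\in N^M(\infty_I;\mathrm{epi}\,f)\}$. $\mathop{\mathrm{Lim\,sup}}_{x\to\infty}\partial f(x)$ is the set of limits $u$ of sequences $u_k\in\partial f(x_k)$ with $x_k\in\mathrm{dom}\,f$, $\|x_k\|\to\infty$. *)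

theory Defs
  imports "HOL-Analysis.Analysis"
begin

text \<open>
  Functions into the reals extended by plus infinity are rendered as \<^typ>\<open>ereal\<close>-valued
  functions that never take the value \<^term>\<open>-\<infinity> :: ereal\<close>; the latter restriction is part of
  \<open>proper_fun\<close>.
\<close>

definition edom :: "('a \<Rightarrow> ereal) \<Rightarrow> 'a set" where
  "edom f = {x. f x < \<infinity>}"

definition proper_fun :: "('a \<Rightarrow> ereal) \<Rightarrow> bool" where
  "proper_fun f \<longleftrightarrow> (\<forall>x. f x \<noteq> -\<infinity>) \<and> edom f \<noteq> {}"

definition lsc_fun :: "('a::topological_space \<Rightarrow> ereal) \<Rightarrow> bool" where
  "lsc_fun f \<longleftrightarrow> (\<forall>x. f x \<le> Liminf (at x) f)"

text \<open>
  The library's \<^const>\<open>convex_on\<close> covers real-valued functions only.  The inequality is meant for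
  functions that omit \<^term>\<open>-\<infinity> :: ereal\<close>, so that the right-hand side is never an
  undetermined sum.
\<close>

definition convex_fun :: "('a::real_vector \<Rightarrow> ereal) \<Rightarrow> bool" where
  "convex_fun f \<longleftrightarrow>
     (\<forall>x y t. 0 < t \<and> t < 1 \<longrightarrow>
        f ((1 - t) *\<^sub>R x + t *\<^sub>R y) \<le> ereal (1 - t) * f x + ereal t * f y)"

definition epi :: "('a \<Rightarrow> ereal) \<Rightarrow> ('a \<times> real) set" where
  "epi f = {(x, r). f x \<le> ereal r}"

text \<open>Intended for convex \<open>E\<close> and \<open>z \<in> E\<close>; all uses below respect \<open>z \<in> E\<close>.\<close>

definition normal_cone :: "'a::real_inner \<Rightarrow> 'a set \<Rightarrow> 'a set" where
  "normal_cone z E = {v. \<forall>y\<in>E. v \<bullet> (y - z) \<le> 0}"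

text \<open>The subdifferential is empty outside the domain.\<close>

definition subdiff :: "('a::euclidean_space \<Rightarrow> ereal) \<Rightarrow> 'a \<Rightarrow> 'a set" where
  "subdiff f x =
     {u. x \<in> edom f \<and> (u, -1) \<in> normal_cone (x, real_of_ereal (f x)) (epi f)}"

text \<open>
  In the following notions a sequence in \<open>E\<close> escapes to infinity in its first component only;
  the second component is unrestricted.
\<close>

definition tangent_cone_inf :: "('a::euclidean_space \<times> real) set \<Rightarrow> ('a \<times> real) set" where
  "tangent_cone_inf E =
     {d. \<forall>z t. (\<forall>k. z k \<in> E) \<and> filterlim (\<lambda>k. norm (fst (z k))) at_top sequentially \<and>
               (\<forall>k. t k > 0) \<and> t \<longlonglongrightarrow> 0 \<longrightarrow>
           (\<exists>e. e \<longlonglongrightarrow> d \<and> (\<forall>k::nat. z k + t k *\<^sub>R e k \<in> E))}"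

definition normal_cone_inf :: "('a::euclidean_space \<times> real) set \<Rightarrow> ('a \<times> real) set" where
  "normal_cone_inf E =
     {(u, c). \<forall>(w, \<rho>)\<in>tangent_cone_inf E. u \<bullet> w + c * \<rho> \<le> 0}"

definition limiting_normal_cone_inf ::
    "('a::euclidean_space \<times> real) set \<Rightarrow> ('a \<times> real) set" where
  "limiting_normal_cone_inf E =
     {v. \<exists>(z :: nat \<Rightarrow> 'a \<times> real) vs.
           (\<forall>k. z k \<in> E) \<and> filterlim (\<lambda>k. norm (fst (z k))) at_top sequentially \<and>
           (\<forall>k. vs k \<in> normal_cone (z k) E) \<and> vs \<longlonglongrightarrow> v}"

definition subdiff_inf :: "('a::euclidean_space \<Rightarrow> ereal) \<Rightarrow> 'a set" where
  "subdiff_inf f = {u. (u, -1) \<in> normal_cone_inf (epi f)}"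

definition singular_subdiff_inf :: "('a::euclidean_space \<Rightarrow> ereal) \<Rightarrow> 'a set" where
  "singular_subdiff_inf f = {u. (u, 0) \<in> normal_cone_inf (epi f)}"

definition limiting_subdiff_inf :: "('a::euclidean_space \<Rightarrow> ereal) \<Rightarrow> 'a set" where
  "limiting_subdiff_inf f = {u. (u, -1) \<in> limiting_normal_cone_inf (epi f)}"

definition Limsup_subdiff_inf :: "('a::euclidean_space \<Rightarrow> ereal) \<Rightarrow> 'a set" where
  "Limsup_subdiff_inf f =
     {u. \<exists>(x :: nat \<Rightarrow> 'a) us.
           (\<forall>k. x k \<in> edom f) \<and> filterlim (\<lambda>k. norm (x k)) at_top sequentially \<and>
           (\<forall>k. us k \<in> subdiff f (x k)) \<and> us \<longlonglongrightarrow> u}"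

end

theory Submission
  imports Defs
begin

text \<open>
  Dividing the inclusion \<open>z\<^sub>k + t\<^sub>k e\<^sub>k \<in> E\<close> by \<open>t\<^sub>k > 0\<close> turns \<open>v\<^sub>k \<in> N(z\<^sub>k; E)\<close> into
  \<open>\<langle>v\<^sub>k, e\<^sub>k\<rangle> \<le> 0\<close>, so limiting normals at infinity are normals at infinity.  A normal to the
  epigraph with negative last component can only occur on the graph, and it rescales to a
  subgradient; along a sequence of normals tending to \<open>(u, -1)\<close> this applies eventually.
\<close>

text \<open>The defining inequalities are linear in the normal, so the cone is an intersection of
  closed half-spaces with 0 on their boundary. Closedness, convexity and conicity all follow from
  this form.\<close>

lemma normal_cone_inf_eq_Inter:
  "normal_cone_inf E = (\<Inter>d\<in>tangent_cone_inf E. {v. d \<bullet> v \<le> 0})"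
  by (force simp: normal_cone_inf_def inner_prod_def inner_commute mult.commute)

lemma closed_normal_cone_inf: "closed (normal_cone_inf E)"
  unfolding normal_cone_inf_eq_Inter by (intro closed_INT ballI closed_halfspace_le)

lemma convex_normal_cone_inf: "convex (normal_cone_inf E)"
  unfolding normal_cone_inf_eq_Inter by (intro convex_INT convex_halfspace_le)

lemma conic_normal_cone_inf: "conic (normal_cone_inf E)"
  unfolding normal_cone_inf_eq_Inter conic_def by (auto intro: mult_nonneg_nonpos)

text \<open>\<open>subdiff_inf\<close> and \<open>singular_subdiff_inf\<close> are the slices of one
  normal cone at heights -1 and 0, so both inherit its closedness.\<close>

lemma closed_slice:
  fixes S :: "('a::topological_space \<times> 'b::topological_space) set"
  assumes "closed S" shows "closed {u. (u, c) \<in> S}"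
proof -
  have "closed ((\<lambda>u. (u, c)) -` S)"
    using assms by (intro closed_vimage continuous_intros)
  then show ?thesis by (simp add: vimage_def)
qed

lemma convex_slice:
  assumes "convex S" shows "convex {u. (u, c) \<in> S}"
  unfolding convex_alt
proof clarify
  fix x y and s :: real
  assume "(x, c) \<in> S" "(y, c) \<in> S" "0 \<le> s" "s \<le> 1"
  then have "(1 - s) *\<^sub>R (x, c) + s *\<^sub>R (y, c) \<in> S"
    using assms unfolding convex_alt by blast
  then show "((1 - s) *\<^sub>R x + s *\<^sub>R y, c) \<in> S"
    by (simp flip: scaleR_left_distrib)
qed

lemma limiting_normal_cone_inf_subset: "limiting_normal_cone_inf E \<subseteq> normal_cone_inf E"
proof
  fix v assume "v \<in> limiting_normal_cone_inf E"
  then obtain z vs where z: "\<And>k::nat. z k \<in> E"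
    and esc: "filterlim (\<lambda>k. norm (fst (z k))) at_top sequentially"
    and vs: "\<And>k. vs k \<in> normal_cone (z k) E" and lim: "vs \<longlonglongrightarrow> v"
    unfolding limiting_normal_cone_inf_def by blast
  have "d \<bullet> v \<le> 0" if d: "d \<in> tangent_cone_inf E" for d
  proof -
    \<comment> \<open>Tangency at infinity covers every positive null sequence, so any single one
      will do. \<open>Suc\<close> keeps the first term positive, as 1 / 0 is 0.\<close>
    define t where "t k = 1 / real (Suc k)" for k
    have t: "\<forall>k. t k > 0" "t \<longlonglongrightarrow> 0"
      unfolding t_def using LIMSEQ_inverse_real_of_nat by (simp_all add: inverse_eq_divide)
    obtain e where e: "e \<longlonglongrightarrow> d" "\<And>k. z k + t k *\<^sub>R e k \<in> E"
      using d z esc t unfolding tangent_cone_inf_def by blast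
    have "vs k \<bullet> e k \<le> 0" for k
    proof -
      have "t k * (vs k \<bullet> e k) \<le> 0"
        using vs[of k] e(2)[of k] by (force simp: normal_cone_def)
      then show ?thesis using t(1) by (metis mult_pos_pos not_less)
    qed
    then have "v \<bullet> d \<le> 0"
      by (intro LIMSEQ_le_const2[OF tendsto_inner[OF lim e(1)]]) blast
    then show ?thesis by (simp add: inner_commute)
  qed
  then show "v \<in> normal_cone_inf E" by (simp add: normal_cone_inf_eq_Inter)
qed

lemma graph_in_epi:
  assumes "x \<in> edom f" shows "(x, real_of_ereal (f x)) \<in> epi f"
  using assms by (cases "f x") (auto simp: edom_def epi_def)

lemma subdiff_of_epi_normal:
  assumes "f x \<noteq> -\<infinity>" and "(x, r) \<in> epi f" and v: "(a, c) \<in> normal_cone (x, r) (epi f)"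
    and c: "c < 0"
  shows "x \<in> edom f" "(- inverse c) *\<^sub>R a \<in> subdiff f x"
proof -
  obtain s where s: "f x = ereal s" "s \<le> r"
    using assms(1,2) by (cases "f x") (auto simp: epi_def)
  show dom: "x \<in> edom f" using s by (simp add: edom_def)
  \<comment> \<open>The normal is tested against the graph point \<open>(x, s)\<close> vertically
    below \<open>(x, r)\<close>; with \<open>c < 0\<close> and \<open>s \<le> r\<close> this forces
    the two to coincide.\<close>
  have "c * (s - r) \<le> 0"
    using v graph_in_epi[OF dom] s by (force simp: normal_cone_def)
  then have "r = s" using c s(2) by (simp add: mult_le_0_iff)
  have "((- inverse c) *\<^sub>R a, -1) \<bullet> (p - (x, s)) \<le> 0" if "p \<in> epi f" for p
  proof -
    \<comment> \<open>The factor \<open>- inverse c\<close> is positive and sends the last component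
      \<open>c\<close> to -1.\<close>
    have "((- inverse c) *\<^sub>R a, -1) \<bullet> (p - (x, s)) = (- inverse c) * ((a, c) \<bullet> (p - (x, s)))"
      using c by (simp add: inner_prod_def field_simps)
    also have "\<dots> \<le> 0"
      using v that c \<open>r = s\<close> by (intro mult_nonneg_nonpos) (auto simp: normal_cone_def)
    finally show ?thesis .
  qed
  then show "(- inverse c) *\<^sub>R a \<in> subdiff f x"
    using dom s by (simp add: subdiff_def normal_cone_def)
qed

text \<open>Subgradients are normals with last component -1 at graph points, so lifting
  \<open>x k\<close> to the graph keeps the escape to infinity and yields a limiting normal.\<close>

lemma Limsup_subdiff_inf_subset: "Limsup_subdiff_inf f \<subseteq> limiting_subdiff_inf f"
proof
  fix u assume "u \<in> Limsup_subdiff_inf f"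
  then obtain x us where x: "\<And>k::nat. x k \<in> edom f"
    and esc: "filterlim (\<lambda>k. norm (x k)) at_top sequentially"
    and us: "\<And>k. us k \<in> subdiff f (x k)" and lim: "us \<longlonglongrightarrow> u"
    unfolding Limsup_subdiff_inf_def by blast
  have "(\<lambda>k. (us k, -1)) \<longlonglongrightarrow> (u, -1 :: real)"
    using lim by (intro tendsto_intros)
  then show "u \<in> limiting_subdiff_inf f"
    using graph_in_epi[OF x] esc us
    unfolding limiting_subdiff_inf_def limiting_normal_cone_inf_def subdiff_def mem_Collect_eq
    by (intro exI[of _ "\<lambda>k. (x k, real_of_ereal (f (x k)))"] exI[of _ "\<lambda>k. (us k, -1)"]) simp
qed

lemma limiting_subdiff_inf_subset:
  assumes "\<And>x. f x \<noteq> -\<infinity>"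
  shows "limiting_subdiff_inf f \<subseteq> Limsup_subdiff_inf f"
proof
  fix u assume "u \<in> limiting_subdiff_inf f"
  then obtain z vs where z: "\<And>k::nat. z k \<in> epi f"
    and esc: "filterlim (\<lambda>k. norm (fst (z k))) at_top sequentially"
    and vs: "\<And>k. vs k \<in> normal_cone (z k) (epi f)" and lim: "vs \<longlonglongrightarrow> (u, -1)"
    unfolding limiting_subdiff_inf_def limiting_normal_cone_inf_def by blast
  have lims: "(\<lambda>k. fst (vs k)) \<longlonglongrightarrow> u" "(\<lambda>k. snd (vs k)) \<longlonglongrightarrow> -1"
    using tendsto_fst[OF lim] tendsto_snd[OF lim] by simp_all
  \<comment> \<open>Rescaling needs a negative last component, which holds only eventually, while
    \<open>Limsup_subdiff_inf\<close> asks for a subgradient at every index. Hence the shift by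
    \<open>N\<close> below.\<close>
  then obtain N where N: "\<And>k. k \<ge> N \<Longrightarrow> snd (vs k) < 0"
    using order_tendstoD(2)[OF lims(2), of 0] by (auto simp: eventually_sequentially)
  define us where "us k = (- inverse (snd (vs k))) *\<^sub>R fst (vs k)" for k
  have "us \<longlonglongrightarrow> (- inverse (-1)) *\<^sub>R u"
    unfolding us_def using lims by (intro tendsto_intros) simp_all
  then have us: "(\<lambda>k. us (k + N)) \<longlonglongrightarrow> u"
    using LIMSEQ_ignore_initial_segment by fastforce
  have esc': "filterlim (\<lambda>k. norm (fst (z (k + N)))) at_top sequentially"
    by (rule filterlim_compose[OF esc filterlim_add_const_nat_at_top])
  have "fst (z (k + N)) \<in> edom f \<and> us (k + N) \<in> subdiff f (fst (z (k + N)))" for k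
    unfolding us_def
    using subdiff_of_epi_normal[of f "fst (z (k + N))" "snd (z (k + N))"
        "fst (vs (k + N))" "snd (vs (k + N))"] assms z[of "k + N"] vs[of "k + N"] N[of "k + N"]
    by simp
  with us esc' show "u \<in> Limsup_subdiff_inf f"
    unfolding Limsup_subdiff_inf_def mem_Collect_eq
    by (intro exI[of _ "\<lambda>k. fst (z (k + N))"] exI[of _ "\<lambda>k. us (k + N)"]) simp
qed

theorem proposition4p3:
  fixes f :: "real ^ 'n \<Rightarrow> ereal"
  assumes "proper_fun f"
    and "lsc_fun f"
    and "convex_fun f"
    and "\<not> bounded (edom f)"
  shows "(closed (subdiff_inf f) \<and> convex (subdiff_inf f) \<and>
          closed (singular_subdiff_inf f) \<and> convex_cone (singular_subdiff_inf f)) \<and>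
         (\<forall>(x :: nat \<Rightarrow> real ^ 'n) us u.
            filterlim (\<lambda>k. norm (x k)) at_top sequentially \<longrightarrow>
            (\<forall>k. us k \<in> subdiff f (x k)) \<longrightarrow>
            us \<longlonglongrightarrow> u \<longrightarrow>
            u \<in> subdiff_inf f) \<and>
         limiting_subdiff_inf f = Limsup_subdiff_inf f \<and>
         Limsup_subdiff_inf f \<subseteq> subdiff_inf f"
proof -
  have "closed (subdiff_inf f)" "convex (subdiff_inf f)"
    "closed (singular_subdiff_inf f)" "convex (singular_subdiff_inf f)"
    unfolding subdiff_inf_def singular_subdiff_inf_def
    by (intro closed_slice convex_slice closed_normal_cone_inf convex_normal_cone_inf)+
  moreover have "conic (singular_subdiff_inf f)"
    using conic_normal_cone_inf[of "epi f"]
    unfolding conic_def singular_subdiff_inf_def by fastforce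
  \<comment> \<open>This supplies the nonemptiness contained in \<open>convex_cone\<close>.\<close>
  moreover have "0 \<in> singular_subdiff_inf f"
    by (auto simp: singular_subdiff_inf_def normal_cone_inf_def)
  moreover have eq: "limiting_subdiff_inf f = Limsup_subdiff_inf f"
    using Limsup_subdiff_inf_subset limiting_subdiff_inf_subset \<open>proper_fun f\<close>
    unfolding proper_fun_def by blast
  \<comment> \<open>This is the slice at height -1 of the inclusion between the two normal cones at
    infinity.\<close>
  moreover have sub: "Limsup_subdiff_inf f \<subseteq> subdiff_inf f"
    using limiting_normal_cone_inf_subset
    unfolding eq[symmetric] limiting_subdiff_inf_def subdiff_inf_def by blast
  moreover have "u \<in> subdiff_inf f"
    if "filterlim (\<lambda>k. norm (x k)) at_top sequentially" "\<forall>k. us k \<in> subdiff f (x k)" "us \<longlonglongrightarrow> u"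
    for x :: "nat \<Rightarrow> real ^ 'n" and us u
  proof -
    \<comment> \<open>Domain membership is built into \<open>subdiff\<close>, so part (ii) reduces
      to the inclusion \<open>sub\<close>.\<close>
    have "\<forall>k. x k \<in> edom f" using that(2) by (simp add: subdiff_def)
    with that have "u \<in> Limsup_subdiff_inf f" unfolding Limsup_subdiff_inf_def by blast
    with sub show ?thesis by blast
  qed
  ultimately show ?thesis
    unfolding convex_cone_def by blast
qed

end
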